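(* For every positive integer $n$, we have $$\operatorname{Cond}(V_n) = \frac{n}{\operatorname{rad}(n)}\, \operatorname{Cond}(V_{\operatorname{rad}(n)}),$$ where $\operatorname{rad}(n)$ denotes the product of all (distinct) prime factors of $n$, and $V_n$ is the Vandermonde matrix associated with the $n$th cyclotomic polynomial.
   Context: For a positive integer $n$, let $m := \varphi(n)$ (Euler's totient function) and let $\zeta_1, \dots, \zeta_m \in \mathbb{C}$ be the primitive $n$th roots of unity (listed in any fixed order). The Vandermonde matrix associated with the $n$th cyclotomic polynomial is the $m \times m$ complex matrix $V_n := (\zeta_i^{\,j-1})_{1 \leq i,j \leq m}$; it is invertible since the $\zeta_i$ are distinct. The condition number of an invertible complex $k \times k$ matrix $A = (a_{i,j})$ is $\operatorname{Cond}(A) := \|A\|\,\|A^{-1}\|$, where $\|A\| := \sqrt{\sum_{i=1}^k \sum_{j=1}^k |a_{i,j}|^2} = \sqrt{\operatorname{Tr}(A^*A)}$ is the Frobenius norm and $A^*$ is the conjugate transpose of $A$. By convention $\operatorname{rad}(1) = 1$ (empty product). *)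

theory Defs
  imports
    Complex_Main
    "HOL-Number_Theory.Totient"
    "Jordan_Normal_Form.Gauss_Jordan_Elimination"
begin

definition rad :: "nat \<Rightarrow> nat" where
  "rad n = \<Prod>(prime_factors n)"

definition primitive_roots_of_unity :: "nat \<Rightarrow> complex set" where
  "primitive_roots_of_unity n = {z. z ^ n = 1 \<and> (\<forall>k. 0 < k \<and> k < n \<longrightarrow> z ^ k \<noteq> 1)}"

definition enumerates_primitive_roots :: "nat \<Rightarrow> (nat \<Rightarrow> complex) \<Rightarrow> bool" where
  "enumerates_primitive_roots n \<zeta> \<longleftrightarrow>
     bij_betw \<zeta> {..<totient n} (primitive_roots_of_unity n)"

(* Indices start at 0, so the exponent is j rather than j - 1. *)
definition cyclotomic_vandermonde :: "nat \<Rightarrow> (nat \<Rightarrow> complex) \<Rightarrow> complex mat" where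
  "cyclotomic_vandermonde n \<zeta> = mat (totient n) (totient n) (\<lambda>(i, j). \<zeta> i ^ j)"

definition frobenius_norm :: "complex mat \<Rightarrow> real" where
  "frobenius_norm A = sqrt (\<Sum>i<dim_row A. \<Sum>j<dim_col A. (cmod (A $$ (i, j)))\<^sup>2)"

(* Only meaningful for invertible A: otherwise mat_inverse A = None. *)
definition condition_number :: "complex mat \<Rightarrow> real" where
  "condition_number A = frobenius_norm A * frobenius_norm (the (mat_inverse A))"

end

theory Submission
  imports Defs "Jordan_Normal_Form.Determinant"
begin

text \<open>
  Write \<open>n = m k\<close> with \<open>m = rad n\<close>. Since \<open>n\<close> and \<open>m\<close> have the same prime factors,
  \<open>z\<close> is a primitive \<open>n\<close>-th root of unity iff \<open>z\<^sup>k\<close> is a primitive \<open>m\<close>-th one, so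
  \<open>z \<mapsto> z\<^sup>k\<close> is \<open>k\<close>-to-one. If \<open>\<ell>\<^sub>w\<close> are the Lagrange polynomials of the primitive
  \<open>m\<close>-th roots, then those of the primitive \<open>n\<close>-th roots are
  \<open>\<ell>\<^bsub>z^k\<^esub>(x\<^sup>k) \<cdot> (1/k) \<Sum>\<^bsub>t<k\<^esub> (x/z)\<^sup>t\<close>. Their coefficients are the columns of the inverse
  Vandermonde matrix, and reading off absolute values shows that the inverses have equal
  Frobenius norm, while the Vandermonde matrix itself has norm \<open>\<phi>(n) = k \<phi>(m)\<close>.
\<close>

lemma sum_lessThan_mult:
  fixes g :: "nat \<Rightarrow> 'a::comm_monoid_add"
  shows "sum g {..<m * k} = (\<Sum>j<m. \<Sum>t<k. g (j * k + t))"
proof -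
  have "sum g {..<m * k} = (\<Sum>j<m. sum g {j * k..<j * k + k})"
    by (rule sum.nat_group [symmetric])
  also have "\<dots> = (\<Sum>j<m. \<Sum>t<k. g (j * k + t))"
  proof (rule sum.cong [OF refl])
    fix j
    show "sum g {j * k..<j * k + k} = (\<Sum>t<k. g (j * k + t))"
      using sum.shift_bounds_nat_ivl [of g 0 "j * k" k]
      by (simp add: add.commute lessThan_atLeast0)
  qed
  finally show ?thesis .
qed

text \<open>For square matrices over a field a right inverse is two-sided and unique, so the
  condition number can be read off from any explicit right inverse.\<close>

lemma mat_inverse_eq_SomeI:
  fixes A B :: "'a::field mat"
  assumes A: "A \<in> carrier_mat n n" and B: "B \<in> carrier_mat n n" and AB: "A * B = 1\<^sub>m n"
  shows "mat_inverse A = Some B"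
proof (cases "mat_inverse A")
  case None
  have "B * A = 1\<^sub>m n"
    by (rule mat_mult_left_right_inverse [OF A B AB])
  then have "A \<in> Units (ring_mat TYPE('a) n ())"
    using A B AB by (auto simp: Units_def ring_mat_simps)
  with mat_inverse(1) [OF A None, where b = "()"] show ?thesis by blast
next
  case (Some C)
  have CA: "C * A = 1\<^sub>m n" and C: "C \<in> carrier_mat n n"
    using mat_inverse(2) [OF A Some] by auto
  have "C * (A * B) = C * A * B"
    by (rule assoc_mult_mat [OF C A B, symmetric])
  then have "C = B"
    using B C by (simp add: AB CA)
  with Some show ?thesis by simp
qed

text \<open>A kernel vector lists the coefficients of a polynomial of degree below \<open>n\<close>
  with \<open>n\<close> distinct roots, so it is zero and the determinant cannot vanish.\<close>

lemma vandermonde_right_inverse: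
  fixes f :: "nat \<Rightarrow> 'a::field"
  assumes inj: "inj_on f {..<n}"
  obtains R where "R \<in> carrier_mat n n" "mat n n (\<lambda>(i, j). f i ^ j) * R = 1\<^sub>m n"
proof -
  define V where "V = mat n n (\<lambda>(i, j). f i ^ j)"
  have V: "V \<in> carrier_mat n n"
    by (simp add: V_def)
  have "det V \<noteq> 0"
  proof
    assume "det V = 0"
    then obtain v where v: "v \<in> carrier_vec n" "v \<noteq> 0\<^sub>v n" "V *\<^sub>v v = 0\<^sub>v n"
      using det_0_iff_vec_prod_zero_field [OF V] by blast
    define p where "p = (\<Sum>j<n. Polynomial.monom (v $ j) j)"
    have coeff_p: "Polynomial.coeff p j = (if j < n then v $ j else 0)" for j
      by (simp add: p_def Polynomial.coeff_sum)
    obtain j where j: "j < n" "v $ j \<noteq> 0"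
      using v(1,2) by (metis carrier_vecD eq_vecI index_zero_vec)
    have "poly p (f i) = 0" if i: "i < n" for i
    proof -
      have "poly p (f i) = (\<Sum>j<n. v $ j * f i ^ j)"
        by (simp add: p_def poly_sum poly_monom)
      also have "\<dots> = (V *\<^sub>v v) $ i"
        using i v(1) by (auto simp: V_def scalar_prod_def lessThan_atLeast0 intro!: sum.cong)
      also have "\<dots> = 0"
        using i v(3) by simp
      finally show ?thesis .
    qed
    \<comment> \<open>The index \<open>j\<close> supplies \<open>n > 0\<close>; the zero polynomial
      has degree 0, so the strict bound fails for \<open>n = 0\<close>.\<close>
    moreover have "Polynomial.degree p < n"
      using j(1) by (intro degree_lessI) (auto simp: coeff_p)
    ultimately have "p = 0"
      using j(1) inj by (intro poly_eqI_degree [of "f ` {..<n}"]) (auto simp: card_image)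
    with coeff_p [of j] j show False by simp
  qed
  then have "V \<in> Units (ring_mat TYPE('a) n ())"
    by (rule det_non_zero_imp_unit [OF V])
  then obtain R where "R \<in> carrier_mat n n" "V * R = 1\<^sub>m n"
    by (auto simp: Units_def ring_mat_simps)
  then show thesis
    using that by (simp add: V_def)
qed

text \<open>Bezout's identity in its subtraction-free form, which makes sense in a monoid without
  inverses.\<close>

lemma power_gcd_eq_1:
  fixes z :: "'a::monoid_mult"
  assumes "z ^ a = 1" "z ^ b = 1" "a \<noteq> 0"
  shows "z ^ gcd a b = 1"
proof -
  obtain x y where "a * x = b * y + gcd a b"
    using bezout_nat [OF assms(3)] by blast
  then have "(z ^ a) ^ x = (z ^ b) ^ y * z ^ gcd a b"
    by (simp flip: power_mult power_add)
  then show ?thesis using assms by simp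
qed

text \<open>If \<open>z ^ j = 1\<close> with \<open>0 < j < n\<close>, then also
  \<open>z ^ d = 1\<close> for the proper divisor \<open>d = gcd n j\<close>. Any prime
  \<open>p\<close> dividing \<open>n / d\<close> makes \<open>n / p\<close> a multiple of
  \<open>d\<close>, contradicting the test at \<open>p\<close>.\<close>

lemma primitive_roots_of_unity_prime_test:
  assumes "n > 0" "z ^ n = 1" "\<And>p. prime p \<Longrightarrow> p dvd n \<Longrightarrow> z ^ (n div p) \<noteq> 1"
  shows "z \<in> primitive_roots_of_unity n"
proof -
  have "z ^ j \<noteq> 1" if j: "0 < j" "j < n" for j
  proof
    assume "z ^ j = 1"
    define d where "d = gcd n j"
    have zd: "z ^ d = 1"
      unfolding d_def using assms \<open>z ^ j = 1\<close> by (intro power_gcd_eq_1) auto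
    have "d \<le> j"
      unfolding d_def using j by (intro dvd_imp_le) auto
    obtain e where e: "n = d * e"
      unfolding d_def by (meson dvdE gcd_dvd1)
    have "e \<noteq> 1"
      using e j \<open>d \<le> j\<close> by auto
    then obtain p where p: "prime p" "p dvd e"
      using prime_factor_nat by blast
    then obtain c where c: "e = p * c" by blast
    have "n div p = d * c"
      using e c p(1) by (simp add: prime_gt_0_nat)
    then have "z ^ (n div p) = 1"
      using zd by (simp add: power_mult)
    with assms(3) [of p] p e show False by simp
  qed
  then show ?thesis
    using assms by (auto simp: primitive_roots_of_unity_def)
qed

lemma primitive_roots_of_unity_mult_iff:
  assumes "m > 0" "k > 0"
    and same_primes: "\<And>p. prime p \<Longrightarrow> p dvd m * k \<Longrightarrow> p dvd m"
  shows "z \<in> primitive_roots_of_unity (m * k) \<longleftrightarrow> z ^ k \<in> primitive_roots_of_unity m"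
proof
  assume "z \<in> primitive_roots_of_unity (m * k)"
  then show "z ^ k \<in> primitive_roots_of_unity m"
    using assms(2) by (auto simp: primitive_roots_of_unity_def mult.commute simp flip: power_mult)
next
  assume w: "z ^ k \<in> primitive_roots_of_unity m"
  show "z \<in> primitive_roots_of_unity (m * k)"
  proof (rule primitive_roots_of_unity_prime_test)
    show "m * k > 0" using assms by simp
    show "z ^ (m * k) = 1"
      using w by (simp add: primitive_roots_of_unity_def mult.commute power_mult)
    fix p :: nat
    assume p: "prime p" "p dvd m * k"
    \<comment> \<open>The exponent to test becomes \<open>k * c\<close>, and
      \<open>(z ^ k) ^ c\<close> differs from 1 because \<open>0 < c < m\<close>.\<close>
    then obtain c where c: "m = p * c"
      using same_primes by blast
    then have "m * k div p = k * c"
      using p(1) by (simp add: prime_gt_0_nat)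
    moreover have "0 < c" "c < m"
      using c assms(1) prime_gt_1_nat [OF p(1)] by auto
    ultimately show "z ^ (m * k div p) \<noteq> 1"
      using w by (simp add: primitive_roots_of_unity_def power_mult)
  qed
qed

lemma norm_primitive_root_of_unity:
  assumes "n > 0" "z \<in> primitive_roots_of_unity n"
  shows "cmod z = 1"
  using assms power_eq_1_iff [of z n] by (auto simp: primitive_roots_of_unity_def)

text \<open>The quotient \<open>z / w\<close> is a \<open>k\<close>-th root of unity, so the
  geometric sum vanishes unless the quotient is 1. This separates roots with the same
  \<open>k\<close>-th power.\<close>

lemma sum_power_quotient_root_of_unity:
  fixes z w :: "'a::field_char_0"
  assumes "z ^ k = w ^ k" "w \<noteq> 0"
  shows "(\<Sum>t<k. (z / w) ^ t) = (if z = w then of_nat k else 0)"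
proof -
  have "(z / w) ^ k = 1"
    using assms by (simp add: power_divide)
  then show ?thesis
    using assms by (simp add: sum_gp_strict)
qed

lemma frobenius_norm_cyclotomic_vandermonde:
  assumes "n > 0" "enumerates_primitive_roots n \<zeta>"
  shows "frobenius_norm (cyclotomic_vandermonde n \<zeta>) = real (totient n)"
proof -
  have "cmod (\<zeta> i) = 1" if "i < totient n" for i
    using assms that by (auto simp: enumerates_primitive_roots_def
        intro!: norm_primitive_root_of_unity [of n] dest: bij_betwE)
  then show ?thesis
    by (simp add: frobenius_norm_def cyclotomic_vandermonde_def norm_power)
qed

theorem theorem1p1:
  fixes n :: nat and \<zeta> \<xi> :: "nat \<Rightarrow> complex"
  assumes "n > 0"
    and "enumerates_primitive_roots n \<zeta>"
    and "enumerates_primitive_roots (rad n) \<xi>"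
  shows "condition_number (cyclotomic_vandermonde n \<zeta>) =
    real n / real (rad n) * condition_number (cyclotomic_vandermonde (rad n) \<xi>)"
proof -
  define m where "m = rad n"
  define k where "k = n div m"
  define M where "M = totient m"
  \<comment> \<open>Divisibility holds factor by factor, since each multiplicity is
    positive.\<close>
  have "m dvd (\<Prod>p\<in>prime_factors n. p ^ multiplicity p n)"
    unfolding m_def rad_def
    by (intro prod_dvd_prod dvd_power) (auto simp: prime_factors_multiplicity)
  then have "m dvd n"
    using assms(1) by (simp add: prod_prime_factors)
  then have n: "n = m * k"
    by (simp add: k_def)
  then have pos: "m > 0" "k > 0"
    using assms(1) by auto
  have "p dvd m" if "prime p" "p dvd m * k" for p
  proof -
    have "p \<in> prime_factors n"
      using that assms(1) by (simp add: prime_factors_dvd n)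
    then show ?thesis
      unfolding m_def rad_def by (intro dvd_prodI) auto
  qed
  then have prim_iff: "z \<in> primitive_roots_of_unity n \<longleftrightarrow> z ^ k \<in> primitive_roots_of_unity m" for z
    unfolding n using pos by (intro primitive_roots_of_unity_mult_iff) auto

  have bij_\<zeta>: "bij_betw \<zeta> {..<totient n} (primitive_roots_of_unity n)"
    and bij_\<xi>: "bij_betw \<xi> {..<M} (primitive_roots_of_unity m)"
    using assms(2,3) by (simp_all add: enumerates_primitive_roots_def m_def M_def)
  have \<zeta>_prim: "\<zeta> i \<in> primitive_roots_of_unity n" if "i < totient n" for i
    using bij_\<zeta> that by (auto dest: bij_betwE)
  have \<xi>_prim: "\<xi> p \<in> primitive_roots_of_unity m" if "p < M" for p
    using bij_\<xi> that by (auto dest: bij_betwE)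
  have norm_\<zeta>: "cmod (\<zeta> i) = 1" if "i < totient n" for i
    using norm_primitive_root_of_unity \<zeta>_prim [OF that] assms(1) by blast
  have \<zeta>_nz: "\<zeta> i \<noteq> 0" if "i < totient n" for i
    using norm_\<zeta> [OF that] by auto

  have "\<exists>p<M. \<xi> p = \<zeta> i ^ k" if "i < totient n" for i
    using \<zeta>_prim [OF that] bij_\<xi> unfolding prim_iff bij_betw_def by (metis imageE lessThan_iff)
  then obtain \<pi> where \<pi>: "\<And>i. i < totient n \<Longrightarrow> \<pi> i < M \<and> \<xi> (\<pi> i) = \<zeta> i ^ k"
    by metis

  \<comment> \<open>By \<open>prim_iff\<close> every \<open>k\<close>-th root of
    \<open>\<xi> p\<close> is a primitive \<open>n\<close>-th root, so the fibre is a full set of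
    \<open>k\<close> roots.\<close>
  have fibre: "card {i \<in> {..<totient n}. \<pi> i = p} = k" if p: "p < M" for p
  proof -
    have "\<xi> p \<noteq> 0"
      using norm_primitive_root_of_unity [OF pos(1) \<xi>_prim [OF p]] by auto
    have "\<zeta> ` {i \<in> {..<totient n}. \<pi> i = p} = {z. z ^ k = \<xi> p}"
    proof (intro equalityI subsetI)
      fix z assume "z \<in> {z. z ^ k = \<xi> p}"
      then have z: "z ^ k = \<xi> p" by simp
      then have "z \<in> primitive_roots_of_unity n"
        using \<xi>_prim [OF p] by (simp add: prim_iff)
      then obtain i where i: "i < totient n" "z = \<zeta> i"
        using bij_\<zeta> by (auto simp: bij_betw_def)
      with z \<pi> p have "\<pi> i = p"
        using bij_\<xi> by (metis bij_betw_def inj_onD lessThan_iff)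
      with i show "z \<in> \<zeta> ` {i \<in> {..<totient n}. \<pi> i = p}" by auto
    qed (use \<pi> in auto)
    moreover have "inj_on \<zeta> {i \<in> {..<totient n}. \<pi> i = p}"
      using bij_\<zeta> by (auto simp: bij_betw_def inj_on_def)
    then have "card (\<zeta> ` {i \<in> {..<totient n}. \<pi> i = p}) = card {i \<in> {..<totient n}. \<pi> i = p}"
      by (rule card_image)
    ultimately show ?thesis
      using card_nth_roots [OF \<open>\<xi> p \<noteq> 0\<close> pos(2)] by simp
  qed
  have fibre_sum: "(\<Sum>i<totient n. g (\<pi> i)) = of_nat k * sum g {..<M}"
    for g :: "nat \<Rightarrow> 'b::semiring_1"
    using sum_fun_comp [of "{..<totient n}" "{..<M}" \<pi> g] \<pi> fibre
    by (auto simp: sum_distrib_left image_subset_iff)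
  \<comment> \<open>Summing the constant 1 over the fibres counts the primitive \<open>n\<close>-th
    roots.\<close>
  have N: "totient n = M * k"
    using fibre_sum [of "\<lambda>_. 1 :: nat"] by simp

  obtain R where R: "R \<in> carrier_mat M M" "mat M M (\<lambda>(i, j). \<xi> i ^ j) * R = 1\<^sub>m M"
    using vandermonde_right_inverse bij_\<xi> unfolding bij_betw_def by blast
  then have inv_\<xi>: "mat_inverse (cyclotomic_vandermonde m \<xi>) = Some R"
    unfolding cyclotomic_vandermonde_def by (intro mat_inverse_eq_SomeI) (auto simp: M_def)
  \<comment> \<open>Column \<open>q\<close> of \<open>R\<close> holds the coefficients of the
    Lagrange polynomial at \<open>\<xi> q\<close>; the sum is its value at
    \<open>\<xi> p\<close>.\<close>
  have R_sum: "(\<Sum>j<M. \<xi> p ^ j * R $$ (j, q)) = (if p = q then 1 else 0)"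
    if "p < M" "q < M" for p q
  proof -
    have "(\<Sum>j<M. \<xi> p ^ j * R $$ (j, q)) = (mat M M (\<lambda>(i, j). \<xi> i ^ j) * R) $$ (p, q)"
      using that R(1) by (auto simp: scalar_prod_def lessThan_atLeast0 intro!: sum.cong)
    then show ?thesis
      using that R(2) by simp
  qed

  \<comment> \<open>Column \<open>i\<close> holds the coefficients of the Lagrange polynomial at
    \<open>\<zeta> i\<close>. Writing \<open>l = j * k + t\<close> with \<open>t < k\<close>, the
    power \<open>x^l\<close> arises only from \<open>x^(k j)\<close> in the first factor and
    \<open>x^t\<close> in the second.\<close>
  define W where "W = mat (M * k) (M * k)
    (\<lambda>(l, i). R $$ (l div k, \<pi> i) * inverse (\<zeta> i) ^ (l mod k) / of_nat k)"
  have W_entry: "W $$ (j * k + t, i) = R $$ (j, \<pi> i) * inverse (\<zeta> i) ^ t / of_nat k"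
    if "j < M" "t < k" "i < M * k" for i j t
  proof -
    have "j * k + t < Suc j * k"
      using that by simp
    also have "\<dots> \<le> M * k"
      using that by (intro mult_le_mono1) simp
    finally show ?thesis
      using that by (simp add: W_def)
  qed
  have VW: "cyclotomic_vandermonde n \<zeta> * W = 1\<^sub>m (M * k)"
  proof (rule eq_matI)
    fix a b
    assume "a < dim_row (1\<^sub>m (M * k))" "b < dim_col (1\<^sub>m (M * k))"
    then have ab: "a < M * k" "b < M * k" by auto
    have bounds: "\<pi> a < M" "\<pi> b < M"
      using ab \<pi> N by auto
    have "(cyclotomic_vandermonde n \<zeta> * W) $$ (a, b) = (\<Sum>l<M * k. \<zeta> a ^ l * W $$ (l, b))"
      using ab by (auto simp: cyclotomic_vandermonde_def N W_def scalar_prod_def lessThan_atLeast0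
          intro!: sum.cong)
    also have "\<dots> = (\<Sum>j<M. \<Sum>t<k. \<zeta> a ^ (j * k + t) *
        (R $$ (j, \<pi> b) * inverse (\<zeta> b) ^ t / of_nat k))"
      unfolding sum_lessThan_mult using ab by (intro sum.cong refl) (simp add: W_entry)
    also have "\<dots> = (\<Sum>j<M. \<Sum>t<k. (\<xi> (\<pi> a) ^ j * R $$ (j, \<pi> b)) * ((\<zeta> a / \<zeta> b) ^ t / of_nat k))"
    proof (intro sum.cong refl)
      fix j t
      have "\<zeta> a ^ (j * k + t) = (\<zeta> a ^ k) ^ j * \<zeta> a ^ t"
        by (metis mult.commute power_add power_mult)
      also have "\<zeta> a ^ k = \<xi> (\<pi> a)"
        using ab \<pi> N by simp
      finally show "\<zeta> a ^ (j * k + t) * (R $$ (j, \<pi> b) * inverse (\<zeta> b) ^ t / of_nat k)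
          = (\<xi> (\<pi> a) ^ j * R $$ (j, \<pi> b)) * ((\<zeta> a / \<zeta> b) ^ t / of_nat k)"
        by (simp add: divide_inverse power_mult_distrib)
    qed
    also have "\<dots> = (\<Sum>j<M. \<xi> (\<pi> a) ^ j * R $$ (j, \<pi> b)) * ((\<Sum>t<k. (\<zeta> a / \<zeta> b) ^ t) / of_nat k)"
      by (simp add: sum_product sum_divide_distrib)
    \<comment> \<open>The first factor is 0 or 1 according to whether \<open>a\<close> and
      \<open>b\<close> lie in different fibres or the same one; within a fibre the geometric sum
      decides.\<close>
    also have "\<dots> = (if a = b then 1 else 0)"
    proof (cases "\<pi> a = \<pi> b")
      case True
      then have "\<zeta> a ^ k = \<zeta> b ^ k"
        using \<pi> ab N by metis
      moreover have "\<zeta> a = \<zeta> b \<longleftrightarrow> a = b"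
        using bij_\<zeta> ab N by (auto simp: bij_betw_def inj_on_def)
      ultimately show ?thesis
        using True bounds \<zeta>_nz [of b] ab pos(2)
        by (simp add: N R_sum sum_power_quotient_root_of_unity)
    next
      case False
      then show ?thesis
        using bounds by (auto simp: R_sum)
    qed
    finally show "(cyclotomic_vandermonde n \<zeta> * W) $$ (a, b) = 1\<^sub>m (M * k) $$ (a, b)"
      using ab by simp
  qed (simp_all add: cyclotomic_vandermonde_def W_def N)
  then have inv_\<zeta>: "mat_inverse (cyclotomic_vandermonde n \<zeta>) = Some W"
    by (intro mat_inverse_eq_SomeI [of _ "M * k"])
      (auto simp: cyclotomic_vandermonde_def W_def N)

  \<comment> \<open>As \<open>\<zeta> i\<close> has modulus 1, the modulus of an entry does not
    depend on \<open>t\<close>.\<close>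
  have "(\<Sum>l<M * k. \<Sum>i<M * k. (cmod (W $$ (l, i)))\<^sup>2)
      = (\<Sum>j<M. \<Sum>t<k. \<Sum>i<M * k. (cmod (R $$ (j, \<pi> i)))\<^sup>2 / (real k)\<^sup>2)"
    unfolding sum_lessThan_mult [where k = k and g = "\<lambda>l. \<Sum>i<M * k. (cmod (W $$ (l, i)))\<^sup>2"]
    by (intro sum.cong refl)
      (simp add: W_entry norm_\<zeta> N norm_mult norm_divide norm_power norm_inverse power_divide)
  also have "\<dots> = (\<Sum>j<M. real k * (\<Sum>i<totient n. (cmod (R $$ (j, \<pi> i)))\<^sup>2 / (real k)\<^sup>2))"
    by (simp add: N)
  \<comment> \<open>One factor \<open>k\<close> comes from the values of \<open>t\<close>, another
    from the fibre size; together they cancel the square of \<open>k\<close>.\<close>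
  also have "\<dots> = (\<Sum>j<M. \<Sum>p<M. (cmod (R $$ (j, p)))\<^sup>2)"
    using pos(2) fibre_sum [of "\<lambda>p. (cmod (R $$ (j, p)))\<^sup>2 / (real k)\<^sup>2" for j]
    by (simp add: power2_eq_square flip: sum_divide_distrib)
  finally have "frobenius_norm W = frobenius_norm R"
    using R(1) by (simp add: frobenius_norm_def W_def)
  moreover have "frobenius_norm (cyclotomic_vandermonde n \<zeta>)
      = real k * frobenius_norm (cyclotomic_vandermonde m \<xi>)"
    using assms pos by (simp add: frobenius_norm_cyclotomic_vandermonde N M_def m_def)
  moreover have "real n / real m = real k"
    using pos by (simp add: n)
  ultimately show ?thesis
    by (simp add: condition_number_def inv_\<zeta> inv_\<xi> flip: m_def)
qed

end
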